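(* Let $d\ge1$ and, for $\alpha\in(0,1)$, let $\nu_\alpha(\mathrm{d}x)=\frac{\alpha\,\mathrm{d}x}{\kappa_{d-1}|x|^{d+\alpha}}$ on $\mathbb{R}^d$. Let $E\subset\mathbb{R}^d$ be a Borel set of finite Lebesgue measure such that $\mathrm{Per}_{\nu_{\alpha_0}}(E)<\infty$ for some $\alpha_0\in(0,1)$. Then $$\lim_{\alpha\downarrow0}\alpha\,\mathrm{Per}_\alpha(E)=\kappa_{d-1}|E|.$$
   Context: $|E|$ is Lebesgue measure. $\kappa_{d-1}=2\pi^{d/2}/\Gamma(d/2)$ is the surface area of $\mathbb{S}^{d-1}$. $\mathrm{Per}_\alpha(E)=\int_E\int_{E^c}|x-y|^{-d-\alpha}\,\mathrm{d}x\,\mathrm{d}y$ for $\alpha\in(0,1)$. For a positive Borel measure $\nu$ on $\mathbb{R}^d$, $\mathrm{Per}_\nu(E)=\int_E\nu(E^c-x)\,\mathrm{d}x$. *)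

theory Defs
  imports "HOL-Analysis.Analysis"
begin

text \<open>Surface area of the unit sphere of $\mathbb{R}^d$, indexed by the dimension $d$ of the
  ambient space, so this is the constant usually written $\kappa_{d-1}$.\<close>

definition sphere_area :: "nat \<Rightarrow> real" where
  "sphere_area d = 2 * pi powr (real d / 2) / Gamma (real d / 2)"

text \<open>Perimeters take values in \<^typ>\<open>ennreal\<close>, since they may be infinite. The kernels below have
  the value 0, instead of infinity, at their singularity; this concerns a null set only (and in
  \<open>frac_perimeter\<close> it never occurs, because the arguments come from disjoint sets).\<close>

definition frac_perimeter :: "real \<Rightarrow> (real ^ 'd) set \<Rightarrow> ennreal" where
  "frac_perimeter \<alpha> E =
     (\<integral>\<^sup>+x\<in>E. (\<integral>\<^sup>+y\<in>- E. ennreal (norm (x - y) powr (- real CARD('d) - \<alpha>)) \<partial>lborel) \<partial>lborel)"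

definition nu_perimeter :: "(real ^ 'd) measure \<Rightarrow> (real ^ 'd) set \<Rightarrow> ennreal" where
  "nu_perimeter \<nu> E = (\<integral>\<^sup>+x\<in>E. emeasure \<nu> ((\<lambda>y. y - x) ` (- E)) \<partial>lborel)"

definition stable_measure :: "real \<Rightarrow> (real ^ 'd) measure" where
  "stable_measure \<alpha> = density lborel
     (\<lambda>x. ennreal (\<alpha> / (sphere_area CARD('d) * norm x powr (real CARD('d) + \<alpha>))))"

end

theory Submission
  imports Defs
begin

text \<open>Split the kernel at distance 1. The far part of the kernel has total mass exactly
  \<open>\<kappa>/\<alpha>\<close> around every point, and the part of that mass lying over \<open>E\<close> is at most \<open>|E|\<close>, since the
  kernel is at most 1 there. The near part is bounded by the kernel of order \<open>\<alpha>\<^sub>0\<close>. Hence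
  \<open>\<kappa>|E| - \<alpha>|E|\<^sup>2 \<le> \<alpha> Per\<^sub>\<alpha>(E) \<le> \<kappa>|E| + \<alpha> Per\<^bsub>\<alpha>\<^sub>0\<^esub>(E)\<close>.\<close>

section \<open>Mass of the kernel at distance more than 1 from its centre\<close>

text \<open>The recursion \<Gamma>(s + 1) = s \<Gamma>(s) at s = d/2 links the two constants.
  Through it, volumes of balls suffice for the radial integral below, without polar
  coordinates.\<close>

lemma sphere_area_eq_unit_ball_vol:
  assumes "d > 0"
  shows "sphere_area d = real d * unit_ball_vol (real d)"
proof -
  have "real d / 2 \<notin> \<int>\<^sub>\<le>\<^sub>0"
    using assms by (auto elim: nonpos_Ints_cases)
  then have "Gamma (real d / 2 + 1) = real d / 2 * Gamma (real d / 2)"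
    by (rule Gamma_plus1)
  then show ?thesis
    using assms unfolding sphere_area_def unit_ball_vol_def by (simp only:) simp
qed

lemma sphere_area_pos: "d > 0 \<Longrightarrow> sphere_area d > 0"
  by (simp add: sphere_area_eq_unit_ball_vol)

text \<open>The integrand has the primitive -t^(-p), which vanishes at infinity. Read from right to
  left, this writes a negative power as an integral over all radii \<open>t\<close> beyond
  \<open>x\<close>, as the layer cake argument requires.\<close>

lemma nn_integral_powr_atLeast:
  fixes x p :: real
  assumes "x > 0" "p > 0"
  shows "(\<integral>\<^sup>+t. ennreal (p * t powr (- p - 1)) * indicator {x..} t \<partial>lborel) = ennreal (x powr (- p))"
proof -
  have lim: "((\<lambda>t. - (t powr (- p))) \<longlongrightarrow> 0) at_top"
    using tendsto_minus[OF tendsto_neg_powr[of "- p", OF _ filterlim_ident]] assms by simp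
  have der: "DERIV (\<lambda>t. - (t powr (- p))) t :> p * t powr (- p - 1)" if "x \<le> t" for t
    using that assms by (auto intro!: derivative_eq_intros)
  have "(\<integral>\<^sup>+t. ennreal (p * t powr (- p - 1)) * indicator {x..} t \<partial>lborel) =
      ennreal (0 - (- (x powr (- p))))"
    by (rule nn_integral_FTC_atLeast[OF _ der _ lim]) (use assms in auto)
  then show ?thesis by simp
qed

lemma nn_integral_norm_powr_outside_ball:
  fixes \<alpha> :: real
  assumes "\<alpha> > 0"
  shows "(\<integral>\<^sup>+z. ennreal (norm z powr (- real DIM('a) - \<alpha>)) * indicator {z. 1 < norm z} z
           \<partial>(lborel :: 'a::euclidean_space measure)) =
         ennreal (sphere_area DIM('a) / \<alpha>)"
proof -
  define n where "n = real DIM('a)"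
  define p where "p = n + \<alpha>"
  define V where "V = unit_ball_vol n"
  have n: "n > 0" and p: "p > 0" and V: "V > 0"
    using assms by (auto simp: n_def p_def V_def)
  define G where "G t = ennreal (p * t powr (- p - 1))" for t :: real
  have [measurable]: "G \<in> borel_measurable borel"
    unfolding G_def by measurable
  \<comment> \<open>Layer cake: write the kernel as an integral over radii \<open>t \<ge> |z|\<close> and exchange the integrals.\<close>
  have shell: "(\<integral>\<^sup>+z. G t * indicator {norm z..} t * indicator {z. 1 < norm z} z
        \<partial>(lborel :: 'a measure)) =
      ennreal (V * p * (t powr (- \<alpha> - 1) - t powr (- p - 1))) * indicator {1..} t" for t
  proof (cases "t \<ge> 1")
    case True
    \<comment> \<open>For fixed \<open>t\<close>, the admissible points fill the shell between the
      balls of radii 1 and \<open>t\<close>, whose volume is V (t^n - 1).\<close>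
    have "(\<integral>\<^sup>+z. G t * indicator {norm z..} t * indicator {z. 1 < norm z} z \<partial>(lborel :: 'a measure)) =
        (\<integral>\<^sup>+z. G t * indicator (cball 0 t - cball 0 1) z \<partial>(lborel :: 'a measure))"
      by (intro nn_integral_cong) (auto simp: indicator_def)
    also have "\<dots> = G t * emeasure lborel (cball 0 t - cball 0 1 :: 'a set)"
      by (subst nn_integral_cmult_indicator) auto
    also have "emeasure lborel (cball 0 t - cball 0 1 :: 'a set) =
        ennreal (V * t ^ DIM('a)) - ennreal V"
      using True by (subst emeasure_Diff) (auto simp: emeasure_cball V_def n_def)
    also have "\<dots> = ennreal (V * t powr n - V)"
      using True V by (simp add: ennreal_minus n_def powr_realpow)
    also have "G t * \<dots> = ennreal (p * t powr (- p - 1) * (V * t powr n - V))"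
      using p by (simp add: G_def ennreal_mult')
    also have "p * t powr (- p - 1) * (V * t powr n - V) =
        V * p * (t powr (- p - 1) * t powr n - t powr (- p - 1))"
      by (simp add: algebra_simps)
    also have "t powr (- p - 1) * t powr n = t powr (- \<alpha> - 1)"
      unfolding powr_add[symmetric] by (rule arg_cong[where f = "(powr) t"]) (simp add: p_def)
    finally show ?thesis using True by simp
  next
    case False
    then have "(\<integral>\<^sup>+z. G t * indicator {norm z..} t * indicator {z. 1 < norm z} z
        \<partial>(lborel :: 'a measure)) = (\<integral>\<^sup>+z. 0 \<partial>(lborel :: 'a measure))"
      by (intro nn_integral_cong) (auto simp: indicator_def)
    with False show ?thesis by simp
  qed
  have "(\<integral>\<^sup>+z. ennreal (norm z powr (- n - \<alpha>)) * indicator {z. 1 < norm z} z \<partial>(lborel :: 'a measure)) =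
      (\<integral>\<^sup>+z. (\<integral>\<^sup>+t. G t * indicator {norm z..} t * indicator {z. 1 < norm z} z \<partial>lborel)
        \<partial>(lborel :: 'a measure))"
  proof (intro nn_integral_cong)
    fix z :: 'a
    have "(\<integral>\<^sup>+t. G t * indicator {norm z..} t \<partial>lborel) = ennreal (norm z powr (- n - \<alpha>))"
      if "1 < norm z"
      using nn_integral_powr_atLeast[of "norm z" p] p order.strict_trans[OF zero_less_one that]
      by (simp add: G_def p_def)
    then show "ennreal (norm z powr (- n - \<alpha>)) * indicator {z. 1 < norm z} z =
      (\<integral>\<^sup>+t. G t * indicator {norm z..} t * indicator {z. 1 < norm z} z \<partial>lborel)"
      by (cases "1 < norm z") auto
  qed
  also have "\<dots> = (\<integral>\<^sup>+t. (\<integral>\<^sup>+z. G t * indicator {norm z..} t * indicator {z. 1 < norm z} z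
        \<partial>(lborel :: 'a measure)) \<partial>lborel)"
    \<comment> \<open>The set \<open>{norm z..}\<close> varies with \<open>z\<close>; unfolded, its
      indicator becomes a condition comparing \<open>norm z\<close> with \<open>t\<close>, which is
      visibly measurable in both variables jointly.\<close>
    unfolding indicator_def atLeast_iff mem_Collect_eq
    by (rule lborel_pair.Fubini') measurable
  also have "\<dots> = (\<integral>\<^sup>+t. ennreal (V * p * (t powr (- \<alpha> - 1) - t powr (- p - 1))) * indicator {1..} t
        \<partial>lborel)"
    by (simp only: shell)
  also have "\<dots> = ennreal (0 - (- (V * p / \<alpha>) * 1 powr (- \<alpha>) + V * 1 powr (- p)))"
  proof (rule nn_integral_FTC_atLeast)
    show "DERIV (\<lambda>t. - (V * p / \<alpha>) * t powr (- \<alpha>) + V * t powr (- p)) t :>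
        V * p * (t powr (- \<alpha> - 1) - t powr (- p - 1))" if "1 \<le> t" for t
      using that assms by (auto intro!: derivative_eq_intros simp: field_simps)
    show "0 \<le> V * p * (t powr (- \<alpha> - 1) - t powr (- p - 1))" if "1 \<le> t" for t
      using that V p n by (auto intro!: mult_nonneg_nonneg powr_mono simp: p_def)
    have "((\<lambda>t::real. - (V * p / \<alpha>) * t powr (- \<alpha>) + V * t powr (- p)) \<longlongrightarrow>
        - (V * p / \<alpha>) * 0 + V * 0) at_top"
      using assms p
      by (intro tendsto_add tendsto_mult tendsto_const tendsto_neg_powr filterlim_ident) auto
    then show "((\<lambda>t::real. - (V * p / \<alpha>) * t powr (- \<alpha>) + V * t powr (- p)) \<longlongrightarrow> 0) at_top"
      by simp
  qed measurable
  \<comment> \<open>Since p = n + \<alpha>, the value V p/\<alpha> - V equals n V/\<alpha>, and n V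
    is the surface area of the sphere.\<close>
  also have "0 - (- (V * p / \<alpha>) * 1 powr (- \<alpha>) + V * 1 powr (- p)) = sphere_area DIM('a) / \<alpha>"
    using assms by (simp add: sphere_area_eq_unit_ball_vol p_def V_def n_def field_simps)
  finally show ?thesis by (simp add: n_def)
qed

lemma nn_integral_lborel_translate:
  fixes x :: "'a::euclidean_space"
  assumes [measurable]: "f \<in> borel_measurable borel"
  shows "(\<integral>\<^sup>+y. f (y - x) \<partial>lborel) = (\<integral>\<^sup>+y. f y \<partial>lborel)"
proof -
  have "(\<integral>\<^sup>+y. f y \<partial>lborel) = (\<integral>\<^sup>+y. f y \<partial>distr lborel borel ((+) (- x)))"
    by (simp add: lborel_distr_plus)
  also have "\<dots> = (\<integral>\<^sup>+y. f (y - x) \<partial>lborel)"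
    by (subst nn_integral_distr) auto
  finally show ?thesis by simp
qed

text \<open>Translation moves the centre from 0 to \<open>x\<close>. The value is independent of
  \<open>x\<close>, so integrating it over \<open>E\<close> produces the leading term
  \<kappa>|E|/\<alpha>.\<close>

lemma nn_integral_far_kernel:
  fixes x :: "real ^ 'd"
  assumes "\<alpha> > 0"
  shows "(\<integral>\<^sup>+y. ennreal (norm (x - y) powr (- real CARD('d) - \<alpha>)) * indicator {y. 1 < norm (x - y)} y
           \<partial>lborel) = ennreal (sphere_area CARD('d) / \<alpha>)"
proof -
  define f where "f z = ennreal (norm z powr (- real CARD('d) - \<alpha>)) * indicator {z. 1 < norm z} z"
    for z :: "real ^ 'd"
  have f: "f \<in> borel_measurable borel"
    unfolding f_def by measurable
  have "(\<integral>\<^sup>+y. f (y - x) \<partial>lborel) = ennreal (sphere_area CARD('d) / \<alpha>)"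
    unfolding nn_integral_lborel_translate[OF f]
    using nn_integral_norm_powr_outside_ball[OF assms, where 'a = "real ^ 'd"]
    by (simp add: f_def[abs_def])
  then show ?thesis
    by (simp add: f_def norm_minus_commute[of x] indicator_def)
qed

section \<open>Comparison of the two notions of perimeter\<close>

text \<open>The substitution z = y - x turns the density of the measure into the kernel, up to a
  constant factor. This transfers the finiteness hypothesis of the theorem to
  \<open>frac_perimeter\<close>.\<close>

lemma nu_perimeter_stable_measure:
  fixes E :: "(real ^ 'd) set"
  assumes [measurable]: "E \<in> sets borel" and "\<alpha> > 0"
  shows "nu_perimeter (stable_measure \<alpha>) E =
    ennreal (\<alpha> / sphere_area CARD('d)) * frac_perimeter \<alpha> E"
proof -
  define c where "c = \<alpha> / sphere_area CARD('d)"
  define K where "K z = ennreal (norm z powr (- real CARD('d) - \<alpha>))" for z :: "real ^ 'd"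
  have c: "c \<ge> 0"
    using assms sphere_area_pos[of "CARD('d)"] by (simp add: c_def)
  have [measurable]: "K \<in> borel_measurable borel"
    unfolding K_def by measurable
  \<comment> \<open>This holds at \<open>z = 0\<close> too: there \<open>powr\<close> and division
    by zero make both sides 0.\<close>
  have K: "ennreal (\<alpha> / (sphere_area CARD('d) * norm z powr (real CARD('d) + \<alpha>))) = ennreal c * K z"
    for z :: "real ^ 'd"
  proof -
    have "norm z powr (- real CARD('d) - \<alpha>) = inverse (norm z powr (real CARD('d) + \<alpha>))"
      using powr_minus[of "norm z" "real CARD('d) + \<alpha>"] by simp
    then show ?thesis
      using c by (simp add: K_def c_def ennreal_mult'[symmetric] divide_inverse mult.assoc)
  qed
  have "emeasure (stable_measure \<alpha>) ((\<lambda>y. y - x) ` (- E)) =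
      ennreal c * (\<integral>\<^sup>+y\<in>- E. ennreal (norm (x - y) powr (- real CARD('d) - \<alpha>)) \<partial>lborel)" for x
  proof -
    have image: "(\<lambda>y. y - x) ` (- E) = (\<lambda>z. z + x) -` (- E)"
      by (force simp: image_iff)
    have [measurable]: "(\<lambda>z. z + x) -` (- E) \<in> sets borel"
      using measurable_sets[of "\<lambda>z. z + x" borel borel "- E"] by simp
    have "emeasure (stable_measure \<alpha>) ((\<lambda>y. y - x) ` (- E)) =
        (\<integral>\<^sup>+z. ennreal c * K z * indicator ((\<lambda>z. z + x) -` (- E)) z \<partial>lborel)"
      unfolding stable_measure_def K image by (rule emeasure_density) auto
    also have "\<dots> = (\<integral>\<^sup>+y. ennreal c * K (y - x) * indicator ((\<lambda>z. z + x) -` (- E)) (y - x) \<partial>lborel)"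
      by (rule nn_integral_lborel_translate[symmetric]) measurable
    also have "\<dots> = (\<integral>\<^sup>+y. ennreal c * (K (x - y) * indicator (- E) y) \<partial>lborel)"
      by (intro nn_integral_cong)
        (auto simp: indicator_def K_def norm_minus_commute)
    also have "\<dots> = ennreal c * (\<integral>\<^sup>+y. K (x - y) * indicator (- E) y \<partial>lborel)"
      by (rule nn_integral_cmult) measurable
    finally show ?thesis by (simp add: K_def)
  qed
  then have "nu_perimeter (stable_measure \<alpha>) E = (\<integral>\<^sup>+x. ennreal c *
      ((\<integral>\<^sup>+y\<in>- E. ennreal (norm (x - y) powr (- real CARD('d) - \<alpha>)) \<partial>lborel) * indicator E x) \<partial>lborel)"
    by (simp add: nu_perimeter_def mult.assoc)
  also have "\<dots> = ennreal c * frac_perimeter \<alpha> E"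
    unfolding frac_perimeter_def by (rule nn_integral_cmult) measurable
  finally show ?thesis by (simp add: c_def)
qed

section \<open>Upper and lower bounds for the fractional perimeter\<close>

text \<open>At distance at most 1 the kernel grows with the order, so order \<beta> dominates. At
  larger distance the part over the complement is at most the whole far mass \<kappa>/\<alpha>,
  which is then integrated over \<open>E\<close>.\<close>

lemma frac_perimeter_upper_bound:
  fixes E :: "(real ^ 'd) set"
  assumes [measurable]: "E \<in> sets borel" and "0 < \<alpha>" "\<alpha> \<le> \<beta>"
  shows "frac_perimeter \<alpha> E \<le>
    frac_perimeter \<beta> E + ennreal (sphere_area CARD('d) / \<alpha>) * emeasure lborel E"
proof -
  define k where "k \<alpha> x y = ennreal (norm (x - y) powr (- real CARD('d) - \<alpha>))"
    for \<alpha> and x y :: "real ^ 'd"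
  have [measurable]: "(\<lambda>(x, y). k \<alpha> x y) \<in> borel_measurable (borel \<Otimes>\<^sub>M borel)" for \<alpha>
    unfolding k_def by measurable
  have inner: "(\<integral>\<^sup>+y\<in>- E. k \<alpha> x y \<partial>lborel) \<le>
      (\<integral>\<^sup>+y\<in>- E. k \<beta> x y \<partial>lborel) + ennreal (sphere_area CARD('d) / \<alpha>)" for x
  proof -
    have pointwise: "k \<alpha> x y * indicator (- E) y \<le>
        k \<beta> x y * indicator (- E) y + k \<alpha> x y * indicator {y. 1 < norm (x - y)} y" for y
    proof (cases "1 < norm (x - y)")
      case True
      then show ?thesis by (auto simp: indicator_def)
    next
      case False
      then have "k \<alpha> x y \<le> k \<beta> x y"
        unfolding k_def using assms by (intro ennreal_leI powr_mono') auto
      then show ?thesis by (auto simp: indicator_def)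
    qed
    have "(\<integral>\<^sup>+y\<in>- E. k \<alpha> x y \<partial>lborel) \<le> (\<integral>\<^sup>+y. k \<beta> x y * indicator (- E) y +
        k \<alpha> x y * indicator {y. 1 < norm (x - y)} y \<partial>lborel)"
      by (intro nn_integral_mono pointwise)
    also have "\<dots> = (\<integral>\<^sup>+y\<in>- E. k \<beta> x y \<partial>lborel) +
        (\<integral>\<^sup>+y. k \<alpha> x y * indicator {y. 1 < norm (x - y)} y \<partial>lborel)"
      by (rule nn_integral_add) measurable
    finally show ?thesis
      using nn_integral_far_kernel[OF \<open>0 < \<alpha>\<close>, of x] by (simp add: k_def)
  qed
  have "frac_perimeter \<alpha> E \<le> (\<integral>\<^sup>+x. (\<integral>\<^sup>+y\<in>- E. k \<beta> x y \<partial>lborel) * indicator E x +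
      ennreal (sphere_area CARD('d) / \<alpha>) * indicator E x \<partial>lborel)"
    unfolding frac_perimeter_def k_def[symmetric] distrib_right[symmetric]
    by (intro nn_integral_mono mult_right_mono inner) simp
  also have "\<dots> = frac_perimeter \<beta> E + (\<integral>\<^sup>+x. ennreal (sphere_area CARD('d) / \<alpha>) * indicator E x \<partial>lborel)"
    unfolding frac_perimeter_def k_def[symmetric] by (rule nn_integral_add) measurable
  finally show ?thesis
    by (simp add: nn_integral_cmult_indicator)
qed

text \<open>The far mass around \<open>x\<close> lies partly over the complement, where it counts
  towards the perimeter, and partly over \<open>E\<close>, where it is at most |E|. That loss stands
  as a summand on the right, which avoids the truncated subtraction of
  \<open>ennreal\<close>.\<close>

lemma frac_perimeter_lower_bound:
  fixes E :: "(real ^ 'd) set"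
  assumes [measurable]: "E \<in> sets borel" and "0 < \<alpha>"
  shows "ennreal (sphere_area CARD('d) / \<alpha>) * emeasure lborel E \<le>
    frac_perimeter \<alpha> E + emeasure lborel E * emeasure lborel E"
proof -
  define k where "k x y = ennreal (norm (x - y) powr (- real CARD('d) - \<alpha>))"
    for x y :: "real ^ 'd"
  have [measurable]: "(\<lambda>(x, y). k x y) \<in> borel_measurable (borel \<Otimes>\<^sub>M borel)"
    unfolding k_def by measurable
  have inner: "ennreal (sphere_area CARD('d) / \<alpha>) \<le>
      (\<integral>\<^sup>+y\<in>- E. k x y \<partial>lborel) + emeasure lborel E" for x
  proof -
    have pointwise: "k x y * indicator {y. 1 < norm (x - y)} y \<le>
        k x y * indicator (- E) y + indicator E y" for y
    proof (cases "1 < norm (x - y) \<and> y \<in> E")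
      case True
      \<comment> \<open>The base exceeds 1 and the exponent is negative, so comparison with exponent
        0 bounds the kernel by 1.\<close>
      then have "k x y \<le> ennreal (norm (x - y) powr 0)"
        unfolding k_def using assms by (intro ennreal_leI powr_mono) auto
      moreover have "norm (x - y) powr 0 = 1"
        using True by auto
      ultimately have "k x y \<le> 1"
        by simp
      with True show ?thesis by (auto simp: indicator_def)
    qed (auto simp: indicator_def)
    have "ennreal (sphere_area CARD('d) / \<alpha>) = (\<integral>\<^sup>+y. k x y * indicator {y. 1 < norm (x - y)} y \<partial>lborel)"
      using nn_integral_far_kernel[OF \<open>0 < \<alpha>\<close>, of x] by (simp add: k_def)
    also have "\<dots> \<le> (\<integral>\<^sup>+y. k x y * indicator (- E) y + indicator E y \<partial>lborel)"
      by (intro nn_integral_mono pointwise)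
    also have "\<dots> = (\<integral>\<^sup>+y\<in>- E. k x y \<partial>lborel) + (\<integral>\<^sup>+y. indicator E y \<partial>lborel)"
      by (rule nn_integral_add) measurable
    finally show ?thesis by simp
  qed
  have "ennreal (sphere_area CARD('d) / \<alpha>) * emeasure lborel E =
      (\<integral>\<^sup>+x. ennreal (sphere_area CARD('d) / \<alpha>) * indicator E x \<partial>lborel)"
    by (simp add: nn_integral_cmult_indicator)
  also have "\<dots> \<le> (\<integral>\<^sup>+x. (\<integral>\<^sup>+y\<in>- E. k x y \<partial>lborel) * indicator E x +
      emeasure lborel E * indicator E x \<partial>lborel)"
    unfolding distrib_right[symmetric]
    by (intro nn_integral_mono mult_right_mono inner) simp
  also have "\<dots> = frac_perimeter \<alpha> E + (\<integral>\<^sup>+x. emeasure lborel E * indicator E x \<partial>lborel)"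
    unfolding frac_perimeter_def k_def[symmetric] by (rule nn_integral_add) measurable
  finally show ?thesis
    by (simp add: nn_integral_cmult_indicator)
qed

section \<open>The squeeze as \<alpha> decreases to 0\<close>

theorem corollary3p14:
  fixes E :: "(real ^ 'd) set" and \<alpha>\<^sub>0 :: real
  assumes "E \<in> sets borel"
    and "emeasure lborel E < \<infinity>"
    and "0 < \<alpha>\<^sub>0" and "\<alpha>\<^sub>0 < 1"
    and "nu_perimeter (stable_measure \<alpha>\<^sub>0) E < \<infinity>"
  shows "((\<lambda>\<alpha>. ennreal \<alpha> * frac_perimeter \<alpha> E) \<longlongrightarrow>
           ennreal (sphere_area CARD('d)) * emeasure lborel E) (at_right 0)"
proof -
  define \<kappa> where "\<kappa> = sphere_area CARD('d)"
  have \<kappa>: "\<kappa> > 0"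
    by (simp add: \<kappa>_def sphere_area_pos)
  obtain e where e: "e \<ge> 0" "emeasure lborel E = ennreal e"
    using assms(2) by (cases "emeasure lborel E") auto
  \<comment> \<open>The two perimeters of order \<open>\<alpha>\<^sub>0\<close> differ by a positive
    factor, so an infinite \<open>frac_perimeter\<close> would contradict the hypothesis.\<close>
  have "frac_perimeter \<alpha>\<^sub>0 E \<noteq> top"
  proof
    assume "frac_perimeter \<alpha>\<^sub>0 E = top"
    then show False
      using assms(5) nu_perimeter_stable_measure[OF assms(1,3)] \<kappa> \<open>0 < \<alpha>\<^sub>0\<close>
      by (simp add: ennreal_mult_top \<kappa>_def)
  qed
  then obtain q where q: "q \<ge> 0" "frac_perimeter \<alpha>\<^sub>0 E = ennreal q"
    by (cases "frac_perimeter \<alpha>\<^sub>0 E") auto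
  \<comment> \<open>The factor \<alpha> cancels the 1/\<alpha> of the far mass, while
    \<open>q\<close> belongs to the fixed order \<open>\<alpha>\<^sub>0\<close>, so its contribution
    vanishes in the limit.\<close>
  have upper: "ennreal \<alpha> * frac_perimeter \<alpha> E \<le> ennreal (\<alpha> * q + \<kappa> * e)"
    if "0 < \<alpha>" "\<alpha> < \<alpha>\<^sub>0" for \<alpha>
  proof -
    have "ennreal \<alpha> * frac_perimeter \<alpha> E \<le> ennreal \<alpha> * (ennreal q + ennreal (\<kappa> / \<alpha>) * ennreal e)"
      using frac_perimeter_upper_bound[OF assms(1), of \<alpha> \<alpha>\<^sub>0] that e q
      by (intro mult_left_mono) (auto simp: \<kappa>_def)
    also have "\<dots> = ennreal (\<alpha> * (q + \<kappa> / \<alpha> * e))"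
      using that \<kappa> e q by (simp flip: ennreal_mult ennreal_plus)
    also have "\<alpha> * (q + \<kappa> / \<alpha> * e) = \<alpha> * q + \<kappa> * e"
      using that by (simp add: field_simps)
    finally show ?thesis .
  qed
  \<comment> \<open>The difference is taken in the reals; where it is negative,
    \<open>ennreal\<close> sends it to 0 and the bound is trivial, so no smallness of \<alpha> has
    to be assumed.\<close>
  have lower: "ennreal (\<kappa> * e - \<alpha> * e\<^sup>2) \<le> ennreal \<alpha> * frac_perimeter \<alpha> E" if "0 < \<alpha>" for \<alpha>
  proof -
    have "ennreal (\<kappa> * e) = ennreal \<alpha> * (ennreal (\<kappa> / \<alpha>) * ennreal e)"
      using that \<kappa> e by (simp flip: ennreal_mult)
    also have "\<dots> \<le> ennreal \<alpha> * (frac_perimeter \<alpha> E + ennreal e * ennreal e)"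
      using frac_perimeter_lower_bound[OF assms(1) that] e
      by (intro mult_left_mono) (auto simp: \<kappa>_def)
    also have "\<dots> = ennreal (\<alpha> * e\<^sup>2) + ennreal \<alpha> * frac_perimeter \<alpha> E"
      using that e by (simp add: distrib_left ennreal_mult power2_eq_square add.commute)
    finally have "ennreal (\<kappa> * e) - ennreal (\<alpha> * e\<^sup>2) \<le> ennreal \<alpha> * frac_perimeter \<alpha> E"
      by (simp add: ennreal_minus_le_iff)
    then show ?thesis
      using that by (simp add: ennreal_minus)
  qed
  have "((\<lambda>\<alpha>. ennreal \<alpha> * frac_perimeter \<alpha> E) \<longlongrightarrow> ennreal (\<kappa> * e)) (at_right 0)"
  proof (rule tendsto_sandwich)
    show "\<forall>\<^sub>F \<alpha> in at_right 0. ennreal (\<kappa> * e - \<alpha> * e\<^sup>2) \<le> ennreal \<alpha> * frac_perimeter \<alpha> E"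
      using lower by (auto intro: eventually_at_right_less[THEN eventually_mono])
    \<comment> \<open>The interval from 0 to \<open>\<alpha>\<^sub>0\<close> serves as the right
      neighbourhood of 0.\<close>
    show "\<forall>\<^sub>F \<alpha> in at_right 0. ennreal \<alpha> * frac_perimeter \<alpha> E \<le> ennreal (\<alpha> * q + \<kappa> * e)"
      using upper assms(3) by (auto simp: eventually_at_right_field)
    have "((\<lambda>\<alpha>. ennreal (\<kappa> * e - \<alpha> * e\<^sup>2)) \<longlongrightarrow> ennreal (\<kappa> * e - 0 * e\<^sup>2)) (at_right 0)"
      by (intro tendsto_intros)
    then show "((\<lambda>\<alpha>. ennreal (\<kappa> * e - \<alpha> * e\<^sup>2)) \<longlongrightarrow> ennreal (\<kappa> * e)) (at_right 0)"
      by simp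
    have "((\<lambda>\<alpha>. ennreal (\<alpha> * q + \<kappa> * e)) \<longlongrightarrow> ennreal (0 * q + \<kappa> * e)) (at_right 0)"
      by (intro tendsto_intros)
    then show "((\<lambda>\<alpha>. ennreal (\<alpha> * q + \<kappa> * e)) \<longlongrightarrow> ennreal (\<kappa> * e)) (at_right 0)"
      by simp
  qed
  then show ?thesis
    using \<kappa> e by (simp add: ennreal_mult \<kappa>_def)
qed

end
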